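(* Let $M,N,K$ be positive integers with $N\le M$, let $\boldsymbol{H}\in\mathbb{C}^{M\times N}$, $\boldsymbol{A}\in\mathbb{C}^{M\times K}$, $\eta>0$, let $\mathcal{F}(\boldsymbol{W})=\frac12\|\boldsymbol{H}\boldsymbol{W}-\boldsymbol{A}\|_F^2$ for $\boldsymbol{W}\in\mathbb{C}^{N\times K}$, and let $$\Omega=\{\boldsymbol{W}\in\mathbb{C}^{N\times K}:\ \mathrm{diag}(\boldsymbol{W}\boldsymbol{W}^H)\le\eta\boldsymbol{1}\}.$$ Let $L>0$ be a Lipschitz constant of $\mathcal{F}$ (in the sense given in the context), and let $\boldsymbol{W}^{opt}$ be an optimal solution of $\min_{\boldsymbol{W}\in\Omega}\mathcal{F}(\boldsymbol{W})$. For any $\boldsymbol{W}^t\in\mathbb{C}^{N\times K}$, let $\boldsymbol{W}^{t+1}$ be generated by the projection gradient descent (PGD) method, i.e. $$\boldsymbol{W}^{t+1}=P_\Omega\big(\boldsymbol{W}^t-\alpha\nabla\mathcal{F}(\boldsymbol{W}^t)\big).$$ If the step size satisfies $\alpha\in(0,1/L)$, then the PGD method converges (the sequence of iterates, started from any initial matrix $\boldsymbol{W}^0\in\mathbb{C}^{N\times K}$, converges), and the following inequalities hold: $$\mathcal{F}(\boldsymbol{W}^{t})-\mathcal{F}(\boldsymbol{W}^{t+1})\ge\Big(\frac1\alpha-L\Big)\|\boldsymbol{W}^t-\boldsymbol{W}^{t+1}\|_F^2,$$ $$\|\boldsymbol{W}^{t}-\boldsymbol{W}^{opt}\|_F^2\ge\|\boldsymbol{W}^{t+1}-\boldsymbol{W}^{opt}\|_F^2+(1-\alpha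 L)\|\boldsymbol{W}^{t}-\boldsymbol{W}^{t+1}\|_F^2.$$
   Context: $\|\cdot\|_F$ is the Frobenius norm, $(\cdot)^H$ the Hermitian transpose, and $\mathrm{Re}[\boldsymbol{X},\boldsymbol{Y}]_F=\mathrm{Re}\,\mathrm{tr}(\boldsymbol{X}^H\boldsymbol{Y})$ the real part of the Frobenius inner product. $\mathrm{diag}(\cdot)$ is the vector of diagonal entries of a square matrix, $\boldsymbol{1}$ is the all-ones vector, and $\le$ between vectors is entrywise; thus $\boldsymbol{W}\in\Omega$ iff $\sum_{k=1}^K|w_{n,k}|^2\le\eta$ for every $n=1,\dots,N$, where $w_{n,k}$ are the entries of $\boldsymbol{W}$. $P_\Omega$ is the projection onto $\Omega$, i.e. $P_\Omega(\boldsymbol{X})$ is the unique point of the closed convex set $\Omega$ closest to $\boldsymbol{X}$ in Frobenius norm. The complex gradient is $\nabla\mathcal{F}(\boldsymbol{W})=\boldsymbol{H}^H\boldsymbol{H}\boldsymbol{W}-\boldsymbol{H}^H\boldsymbol{A}$. A constant $L>0$ is a Lipschitz constant of $\mathcal{F}$ if for all $\boldsymbol{X},\boldsymbol{Y}\in\mathbb{C}^{N\times K}$ $$\mathcal{F}(\boldsymbol{Y})\le\mathcal{F}(\boldsymbol{X})+\mathrm{Re}[\nabla\mathcal{F}(\boldsymbol{X}),\boldsymbol{Y}-\boldsymbol{X}]_F+\frac{L}{2}\|\boldsymbol{Y}-\boldsymbol{X}\|_F^2 .$$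
   Formalization: The first inequality is stated only for W^t in Ω (hence for all iterates t ≥ 1), since for W^t outside Ω it is false: with H = 0, A = 0 the left side is 0 and the right side is positive. *)

theory Defs
  imports "HOL-Analysis.Analysis" "HOL-Library.Complex_Order"
begin

text \<open>A complex matrix with rows indexed by 'a and columns indexed by 'b has type
  complex ^ 'b ^ 'a. The library norm on this type is the Frobenius norm, and its dist is the
  distance induced by that norm; see the lemma norm_eq_Frobenius below.\<close>

definition hermitian_transpose :: "complex ^ 'b ^ 'a \<Rightarrow> complex ^ 'a ^ 'b"
  where "hermitian_transpose X = map_matrix cnj (transpose X)"

definition re_inner_F :: "complex ^ 'b ^ 'a \<Rightarrow> complex ^ 'b ^ 'a \<Rightarrow> real"
  where "re_inner_F X Y = Re (trace (hermitian_transpose X ** Y))"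

definition diag_vec :: "'c ^ 'a ^ 'a \<Rightarrow> 'c ^ 'a"
  where "diag_vec X = (\<chi> i. X $ i $ i)"

definition objective :: "complex ^ 'n ^ 'm \<Rightarrow> complex ^ 'k ^ 'm \<Rightarrow> complex ^ 'k ^ 'n \<Rightarrow> real"
  where "objective H A W = 1 / 2 * (norm (H ** W - A))\<^sup>2"

definition gradient ::
    "complex ^ 'n ^ 'm \<Rightarrow> complex ^ 'k ^ 'm \<Rightarrow> complex ^ 'k ^ 'n \<Rightarrow> complex ^ 'k ^ 'n"
  where "gradient H A W =
    hermitian_transpose H ** H ** W - hermitian_transpose H ** A"

text \<open>The order on complex vectors is entrywise, and the order on complex numbers compares real
  parts and requires equal imaginary parts; both diagonals compared here are real.\<close>

definition feasible :: "real \<Rightarrow> (complex ^ 'k ^ 'n) set"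
  where "feasible \<eta> = {W. diag_vec (W ** hermitian_transpose W) \<le> (\<chi> i. of_real \<eta>)}"

definition is_Lipschitz_constant ::
    "complex ^ 'n ^ 'm \<Rightarrow> complex ^ 'k ^ 'm \<Rightarrow> real \<Rightarrow> bool"
  where "is_Lipschitz_constant H A L \<longleftrightarrow>
    L > 0 \<and>
    (\<forall>X Y. objective H A Y \<le>
       objective H A X + re_inner_F (gradient H A X) (Y - X) + L / 2 * (norm (Y - X))\<^sup>2)"

definition pgd_step ::
    "complex ^ 'n ^ 'm \<Rightarrow> complex ^ 'k ^ 'm \<Rightarrow> real \<Rightarrow> real \<Rightarrow> complex ^ 'k ^ 'n \<Rightarrow> complex ^ 'k ^ 'n"
  where "pgd_step H A \<eta> \<alpha> W = closest_point (feasible \<eta>) (W - \<alpha> *\<^sub>R gradient H A W)"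

lemma norm_eq_Frobenius:
  fixes X :: "complex ^ 'b ^ 'a"
  shows "norm X = sqrt (\<Sum>i\<in>UNIV. \<Sum>j\<in>UNIV. (cmod (X $ i $ j))\<^sup>2)"
  by (simp add: norm_vec_def L2_set_def sum_nonneg)

lemma re_inner_F_eq_inner: "re_inner_F X Y = X \<bullet> Y"
proof -
  have "re_inner_F X Y = (\<Sum>j\<in>UNIV. \<Sum>i\<in>UNIV. X $ i $ j \<bullet> Y $ i $ j)"
    by (simp add: re_inner_F_def trace_def hermitian_transpose_def transpose_def
        matrix_matrix_mult_def inner_complex_def)
  also have "\<dots> = X \<bullet> Y"
    by (subst sum.swap) (simp add: inner_vec_def)
  finally show ?thesis .
qed

lemma feasible_iff:
  fixes W :: "complex ^ 'k ^ 'n"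
  shows "W \<in> feasible \<eta> \<longleftrightarrow> (\<forall>n. (\<Sum>k\<in>UNIV. (cmod (W $ n $ k))\<^sup>2) \<le> \<eta>)"
proof -
  have "(W ** hermitian_transpose W) $ n $ n
      = of_real (\<Sum>k\<in>UNIV. (cmod (W $ n $ k))\<^sup>2)" for n
    by (simp add: hermitian_transpose_def transpose_def matrix_matrix_mult_def
        complex_norm_square del: of_real_power)
  then show ?thesis
    by (simp add: feasible_def diag_vec_def less_eq_vec_def less_eq_complex_def del: of_real_sum)
qed

lemma closed_feasible: "closed (feasible \<eta> :: (complex ^ 'k ^ 'n) set)"
proof -
  have "feasible \<eta> = (\<Inter>n. {W :: complex ^ 'k ^ 'n. (\<Sum>k\<in>UNIV. (cmod (W $ n $ k))\<^sup>2) \<le> \<eta>})"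
    by (auto simp: feasible_iff)
  then show ?thesis
    by (auto intro!: closed_INT closed_Collect_le continuous_intros)
qed

lemma pgd_step_feasible:
  assumes "\<eta> > 0"
  shows "pgd_step H A \<eta> \<alpha> W \<in> feasible \<eta>"
proof -
  have "(0 :: complex ^ 'a ^ 'b) \<in> feasible \<eta>"
    using assms by (simp add: feasible_iff)
  then show ?thesis
    unfolding pgd_step_def by (intro closest_point_in_set closed_feasible) auto
qed

text \<open>The sufficient decrease inequality needs a feasible current point: for the zero
  objective it fails at every infeasible one. By the lemma pgd_step_feasible, all iterates
  after the initial one are feasible.\<close>

lemma decrease_fails_at_infeasible:
  fixes W :: "complex ^ 'k ^ 'n"
  assumes "\<eta> > 0" "L > 0" "\<alpha> \<in> {0<..<1 / L}" "W \<notin> feasible \<eta>"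
  defines "H \<equiv> (0 :: complex ^ 'n ^ 'm)" and "A \<equiv> (0 :: complex ^ 'k ^ 'm)"
  shows "is_Lipschitz_constant H A L"
    and "objective H A W - objective H A (pgd_step H A \<eta> \<alpha> W)
      < (1 / \<alpha> - L) * (norm (W - pgd_step H A \<eta> \<alpha> W))\<^sup>2"
proof -
  have obj: "objective H A X = 0" for X :: "complex ^ 'k ^ 'n"
    by (simp add: objective_def H_def A_def matrix_matrix_mult_def vec_eq_iff)
  have grad: "gradient H A X = 0" for X :: "complex ^ 'k ^ 'n"
    by (simp add: gradient_def hermitian_transpose_def H_def A_def matrix_matrix_mult_def
        transpose_def map_matrix_def vec_eq_iff)
  show "is_Lipschitz_constant H A L"
    using assms(2) by (simp add: is_Lipschitz_constant_def obj grad re_inner_F_eq_inner)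
  have "W \<noteq> pgd_step H A \<eta> \<alpha> W"
    using pgd_step_feasible[OF assms(1)] assms(4) by metis
  moreover have "1 / \<alpha> - L > 0"
    using assms(2,3) by (simp add: field_simps)
  ultimately show "objective H A W - objective H A (pgd_step H A \<eta> \<alpha> W)
      < (1 / \<alpha> - L) * (norm (W - pgd_step H A \<eta> \<alpha> W))\<^sup>2"
    by (simp add: obj)
qed

end

theory Submission
  imports Defs
begin

text \<open>The theorem is an instance of a fact about projected gradient steps
  \<open>T x = P\<^sub>S (x - \<alpha> g x)\<close> for a convex function \<open>f\<close> with gradient \<open>g\<close>, over a closed convex set
  \<open>S\<close>. Everything comes from one three-point inequality, lemma \<open>three_point\<close>: for every \<open>x\<close> and
  every \<open>z \<in> S\<close>,
  \<open>2 \<alpha> (f (T x) - f z) \<le> |x - z|\<^sup>2 - |T x - z|\<^sup>2 - (1 - \<alpha> L) |x - T x|\<^sup>2\<close>.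
  It combines the quadratic upper bound on \<open>f\<close> at \<open>T x\<close>, the linear lower bound on \<open>f\<close> at \<open>z\<close>
  that convexity gives, and the obtuse angle at \<open>T x\<close> that characterizes the projection.

  Three choices of \<open>z\<close> and \<open>x\<close> then suffice. Taking \<open>z = x \<in> S\<close> gives sufficient decrease.
  Taking for \<open>z\<close> a minimizer makes the left side nonnegative and gives the Fejer-type distance
  inequality. Taking for \<open>x\<close> a fixed point of \<open>T\<close> makes the right side vanish, so every fixed point
  is a minimizer. For convergence of the iterates, the distance inequality to one minimizer
  shows that the iterates are bounded and that their increments tend to zero; by compactness and
  continuity of \<open>T\<close> some subsequence tends to a fixed point. That point is itself a
  minimizer, so the distances to it are nonincreasing as well, and since a subsequence of
  them tends to zero, they all do.

  For the least squares objective, convexity is the exact expansion of the square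
  (lemma \<open>objective_expansion\<close>), and the feasible set is convex because it bounds the
  Euclidean norm of each row.\<close>

section \<open>Projected gradient steps in a Euclidean space\<close>

text \<open>The two bounds encode that \<open>g x\<close> is the gradient of a convex function: \<open>lower_bound\<close> makes
  it a subgradient, and \<open>upper_bound\<close> makes \<open>L\<close> a smoothness constant.\<close>

locale projected_gradient =
  fixes f :: "'a::euclidean_space \<Rightarrow> real" and g :: "'a \<Rightarrow> 'a" and S :: "'a set"
    and L \<alpha> :: real
  assumes closed_S: "closed S" and convex_S: "convex S" and nonempty_S: "S \<noteq> {}"
    and lower_bound: "f x + g x \<bullet> (y - x) \<le> f y"
    and upper_bound: "f y \<le> f x + g x \<bullet> (y - x) + L / 2 * (norm (y - x))\<^sup>2"
    and continuous_gradient: "continuous_on UNIV g"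
    and L_pos: "0 < L" and step_pos: "0 < \<alpha>" and step_less: "\<alpha> * L < 1"
begin

definition T :: "'a \<Rightarrow> 'a"
  where "T x = closest_point S (x - \<alpha> *\<^sub>R g x)"

lemma T_in: "T x \<in> S"
  unfolding T_def using closed_S nonempty_S by (rule closest_point_in_set)

lemma three_point:
  assumes "z \<in> S"
  shows "2 * \<alpha> * (f (T x) - f z)
    \<le> (norm (x - z))\<^sup>2 - (norm (T x - z))\<^sup>2 - (1 - \<alpha> * L) * (norm (x - T x))\<^sup>2"
proof -
  have "(x - \<alpha> *\<^sub>R g x - T x) \<bullet> (z - T x) \<le> 0"
    unfolding T_def using convex_S closed_S assms by (rule closest_point_dot)
  then have angle: "2 * \<alpha> * (g x \<bullet> (T x - z)) \<le> 2 * ((x - T x) \<bullet> (T x - z))"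
    by (simp add: inner_simps algebra_simps)
  have polarization: "2 * ((x - T x) \<bullet> (T x - z))
      = (norm (x - z))\<^sup>2 - (norm (x - T x))\<^sup>2 - (norm (T x - z))\<^sup>2"
    unfolding power2_norm_eq_inner by (simp add: inner_simps inner_commute algebra_simps)
  have "f (T x) - f z \<le> g x \<bullet> (T x - x) - g x \<bullet> (z - x) + L / 2 * (norm (T x - x))\<^sup>2"
    using lower_bound[of x z] upper_bound[of "T x" x] by linarith
  also have "\<dots> = g x \<bullet> (T x - z) + L / 2 * (norm (x - T x))\<^sup>2"
    by (simp add: inner_simps norm_minus_commute)
  finally have "2 * \<alpha> * (f (T x) - f z)
      \<le> 2 * \<alpha> * (g x \<bullet> (T x - z) + L / 2 * (norm (x - T x))\<^sup>2)"
    using step_pos by (intro mult_left_mono) auto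
  also have "\<dots> = 2 * \<alpha> * (g x \<bullet> (T x - z)) + \<alpha> * L * (norm (x - T x))\<^sup>2"
    by (simp add: algebra_simps)
  finally show ?thesis
    using angle polarization by (simp add: algebra_simps)
qed

text \<open>For \<open>z = x\<close> the term \<open>|T x - z|\<^sup>2\<close> adds to the last one. This yields even the factor
  \<open>1 / \<alpha> - L / 2\<close>, which exceeds the one claimed.\<close>

lemma sufficient_decrease:
  assumes "x \<in> S"
  shows "(1 / \<alpha> - L) * (norm (x - T x))\<^sup>2 \<le> f x - f (T x)"
proof -
  have "2 * \<alpha> * (f (T x) - f x) \<le> - (2 - \<alpha> * L) * (norm (x - T x))\<^sup>2"
    using three_point[OF assms, of x] by (simp add: norm_minus_commute algebra_simps)
  then have "(1 / \<alpha> - L / 2) * (norm (x - T x))\<^sup>2 \<le> f x - f (T x)"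
    using step_pos by (simp add: field_simps)
  moreover have "(1 / \<alpha> - L) * (norm (x - T x))\<^sup>2 \<le> (1 / \<alpha> - L / 2) * (norm (x - T x))\<^sup>2"
    using L_pos by (intro mult_right_mono) auto
  ultimately show ?thesis by linarith
qed

lemma distance_decrease:
  assumes "z \<in> S" and "\<And>y. y \<in> S \<Longrightarrow> f z \<le> f y"
  shows "(norm (T x - z))\<^sup>2 + (1 - \<alpha> * L) * (norm (x - T x))\<^sup>2 \<le> (norm (x - z))\<^sup>2"
proof -
  have "0 \<le> 2 * \<alpha> * (f (T x) - f z)"
    using assms(2)[OF T_in] step_pos by simp
  then show ?thesis
    using three_point[OF assms(1), of x] by linarith
qed

text \<open>At a fixed point the distances on the right of the three-point inequality cancel.\<close>

lemma fixed_point_minimal: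
  assumes "T p = p" and "z \<in> S"
  shows "f p \<le> f z"
  using three_point[OF assms(2), of p] assms(1) step_pos by (simp add: mult_le_0_iff)

lemma continuous_T: "continuous_on UNIV T"
proof -
  have "continuous_on UNIV (closest_point S)"
    using convex_S closed_S nonempty_S by (rule continuous_on_closest_point)
  moreover have "continuous_on UNIV (\<lambda>x. x - \<alpha> *\<^sub>R g x)"
    by (intro continuous_intros continuous_gradient)
  ultimately show ?thesis
    unfolding T_def by (rule continuous_on_compose2) simp
qed

lemma distance_antimono:
  assumes "z \<in> S" and "\<And>y. y \<in> S \<Longrightarrow> f z \<le> f y"
  shows "decseq (\<lambda>t. norm ((T ^^ t) x - z))"
proof (rule decseq_SucI)
  fix t
  have "0 \<le> (1 - \<alpha> * L) * (norm ((T ^^ t) x - T ((T ^^ t) x)))\<^sup>2"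
    using step_less by simp
  then have "(norm (T ((T ^^ t) x) - z))\<^sup>2 \<le> (norm ((T ^^ t) x - z))\<^sup>2"
    using distance_decrease[OF assms, of "(T ^^ t) x"] by linarith
  then show "norm ((T ^^ Suc t) x - z) \<le> norm ((T ^^ t) x - z)"
    unfolding funpow.simps o_apply by (rule power2_le_imp_le) simp
qed

text \<open>The squared distances to a minimizer are nonincreasing and nonnegative, hence convergent, so
  their successive differences tend to zero, and these dominate \<open>1 - \<alpha> L\<close> times the squared
  increments.\<close>

lemma increments_tendsto_zero:
  assumes "z \<in> S" and "\<And>y. y \<in> S \<Longrightarrow> f z \<le> f y"
  shows "(\<lambda>t. (T ^^ t) x - T ((T ^^ t) x)) \<longlonglongrightarrow> 0"
proof -
  define d where "d t = (norm ((T ^^ t) x - z))\<^sup>2" for t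
  obtain l where "(\<lambda>t. norm ((T ^^ t) x - z)) \<longlonglongrightarrow> l"
    using decseq_convergent[OF distance_antimono[OF assms, of x], of 0] by auto
  then have lim: "d \<longlonglongrightarrow> l\<^sup>2"
    unfolding d_def by (rule tendsto_power)
  have "(\<lambda>t. (d t - d (Suc t)) / (1 - \<alpha> * L)) \<longlonglongrightarrow> (l\<^sup>2 - l\<^sup>2) / (1 - \<alpha> * L)"
    using step_less by (intro tendsto_intros lim LIMSEQ_Suc) auto
  then have null: "(\<lambda>t. (d t - d (Suc t)) / (1 - \<alpha> * L)) \<longlonglongrightarrow> 0"
    by simp
  have bound: "(norm ((T ^^ t) x - T ((T ^^ t) x)))\<^sup>2 \<le> (d t - d (Suc t)) / (1 - \<alpha> * L)" for t
  proof -
    have "(norm ((T ^^ t) x - T ((T ^^ t) x)))\<^sup>2 * (1 - \<alpha> * L) \<le> d t - d (Suc t)"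
      using distance_decrease[OF assms, of "(T ^^ t) x"] unfolding d_def funpow.simps o_apply
      by (simp only: mult.commute le_diff_eq add.commute)
    moreover have "0 < 1 - \<alpha> * L"
      using step_less by simp
    ultimately show ?thesis
      by (simp only: pos_le_divide_eq)
  qed
  have "(\<lambda>t. (norm ((T ^^ t) x - T ((T ^^ t) x)))\<^sup>2) \<longlonglongrightarrow> 0"
    by (rule Lim_null_comparison[OF always_eventually null]) (simp add: bound)
  then show ?thesis
    by (simp add: tendsto_norm_zero_iff)
qed

text \<open>The limit need not be the given minimizer \<open>z\<close>: compactness supplies a limit point \<open>p\<close> that
  is a fixed point, and the distances to \<open>p\<close> are then monotone because \<open>p\<close> is a minimizer too.\<close>

theorem iterates_convergent:
  assumes "z \<in> S" and "\<And>y. y \<in> S \<Longrightarrow> f z \<le> f y"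
  shows "convergent (\<lambda>t. (T ^^ t) x)"
proof -
  have "(T ^^ t) x \<in> cball z (norm (x - z))" for t
    using decseqD[OF distance_antimono[OF assms, of x], of 0 t]
    by (simp add: dist_norm norm_minus_commute)
  then obtain p r where r: "strict_mono (r :: nat \<Rightarrow> nat)"
    and lim: "((\<lambda>t. (T ^^ t) x) \<circ> r) \<longlonglongrightarrow> p"
    using compact_cball[of z "norm (x - z)"] unfolding compact_def by metis
  have "isCont T p"
    using continuous_T by (simp add: continuous_on_eq_continuous_at)
  then have "(\<lambda>t. (T ^^ r t) x - T ((T ^^ r t) x)) \<longlonglongrightarrow> p - T p"
    using lim by (intro tendsto_diff isCont_tendsto_compose[of p T]) (auto simp: o_def)
  moreover have "(\<lambda>t. (T ^^ r t) x - T ((T ^^ r t) x)) \<longlonglongrightarrow> 0"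
    using LIMSEQ_subseq_LIMSEQ[OF increments_tendsto_zero[OF assms, of x] r] by (simp add: o_def)
  ultimately have fixed: "T p = p"
    using LIMSEQ_unique by fastforce
  then have "p \<in> S"
    using T_in[of p] by simp
  then have dec: "decseq (\<lambda>t. norm ((T ^^ t) x - p))"
    using fixed_point_minimal[OF fixed] by (rule distance_antimono)
  then obtain l where l: "(\<lambda>t. norm ((T ^^ t) x - p)) \<longlonglongrightarrow> l"
    using decseq_convergent[of _ 0] by (metis norm_ge_zero)
  have "(\<lambda>t. norm ((T ^^ r t) x - p)) \<longlonglongrightarrow> 0"
    using lim by (simp add: o_def tendsto_norm_zero_iff LIM_zero_iff)
  moreover have "(\<lambda>t. norm ((T ^^ r t) x - p)) \<longlonglongrightarrow> l"
    using LIMSEQ_subseq_LIMSEQ[OF l r] by (simp add: o_def)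
  ultimately have "l = 0"
    using LIMSEQ_unique by blast
  then have "(\<lambda>t. (T ^^ t) x) \<longlonglongrightarrow> p"
    using l by (simp add: tendsto_norm_zero_iff LIM_zero_iff)
  then show ?thesis
    by (rule convergentI)
qed

end

section \<open>The least squares objective and the row-norm constraint\<close>

text \<open>The real inner product of the matrix space is the real part of the Frobenius product, so
  the adjoint of left multiplication by \<open>H\<close> is left multiplication by its conjugate transpose.\<close>

lemma inner_matrix_mult_left:
  fixes H :: "complex ^ 'n ^ 'm"
  shows "(H ** X) \<bullet> Y = X \<bullet> (hermitian_transpose H ** Y)"
proof -
  have "hermitian_transpose (H ** X) = hermitian_transpose X ** hermitian_transpose H"
    by (simp add: hermitian_transpose_def transpose_def map_matrix_def matrix_matrix_mult_def
        vec_eq_iff mult.commute)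
  then show ?thesis
    unfolding re_inner_F_eq_inner[symmetric] re_inner_F_def by (simp add: matrix_mul_assoc)
qed

lemma matrix_mult_diff_distrib:
  fixes B :: "'a::ring_1 ^ 'n ^ 'm"
  shows "B ** (X - Y) = B ** X - B ** Y"
  by (simp add: matrix_matrix_mult_def vec_eq_iff sum_subtractf right_diff_distrib)

text \<open>The last term is nonnegative, which is the convexity of the objective; it is the whole gap
  because the objective is quadratic.\<close>

lemma objective_expansion:
  "objective H A Y
    = objective H A X + gradient H A X \<bullet> (Y - X) + 1 / 2 * (norm (H ** (Y - X)))\<^sup>2"
proof -
  define R D where "R = H ** X - A" and "D = H ** (Y - X)"
  have residual: "H ** Y - A = R + D"
    by (simp add: R_def D_def matrix_mult_diff_distrib)
  have "gradient H A X = hermitian_transpose H ** R"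
    by (simp add: gradient_def R_def matrix_mult_diff_distrib matrix_mul_assoc)
  then have grad: "gradient H A X \<bullet> (Y - X) = R \<bullet> D"
    by (metis D_def inner_matrix_mult_left inner_commute)
  show ?thesis
    unfolding objective_def residual grad R_def[symmetric] D_def[symmetric]
    by (simp add: power2_norm_eq_inner inner_simps inner_commute algebra_simps)
qed

lemma continuous_gradient_least_squares: "continuous_on UNIV (gradient H A)"
  unfolding gradient_def matrix_matrix_mult_def by (intro continuous_intros)

lemma convex_feasible: "convex (feasible \<eta> :: (complex ^ 'k ^ 'n) set)"
proof -
  have row: "(\<Sum>k\<in>UNIV. (cmod (W $ n $ k))\<^sup>2) = (norm (W $ n))\<^sup>2"
    for W :: "complex ^ 'k ^ 'n" and n
    by (simp add: norm_vec_def L2_set_def sum_nonneg)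
  have "(norm (v :: complex ^ 'k))\<^sup>2 \<le> \<eta> \<longleftrightarrow> v \<in> cball 0 (sqrt \<eta>)" for v
    by (metis abs_norm_cancel dist_0_norm mem_cball real_sqrt_abs real_sqrt_le_iff)
  then have "feasible \<eta> = (\<Inter>n. (\<lambda>W :: complex ^ 'k ^ 'n. W $ n) -` cball 0 (sqrt \<eta>))"
    by (auto simp: feasible_iff row)
  moreover have "convex ((\<lambda>W :: complex ^ 'k ^ 'n. W $ n) -` cball 0 (sqrt \<eta>))" for n
    by (intro convex_linear_vimage convex_cball) (simp add: linear_iff)
  ultimately show ?thesis
    by (simp add: convex_INT)
qed

theorem theorem3:
  fixes H :: "complex ^ 'n ^ 'm"
    and A :: "complex ^ 'k ^ 'm"
    and Wopt :: "complex ^ 'k ^ 'n"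
    and \<eta> L \<alpha> :: real
  assumes "CARD('n) \<le> CARD('m)"
    and "\<eta> > 0"
    and "is_Lipschitz_constant H A L"
    and "is_arg_min (objective H A) (\<lambda>W. W \<in> feasible \<eta>) Wopt"
    and "\<alpha> \<in> {0<..<1 / L}"
  shows "(\<forall>W0. convergent (\<lambda>t. (pgd_step H A \<eta> \<alpha> ^^ t) W0)) \<and>
    (\<forall>W\<in>feasible \<eta>.
      objective H A W - objective H A (pgd_step H A \<eta> \<alpha> W)
        \<ge> (1 / \<alpha> - L) * (norm (W - pgd_step H A \<eta> \<alpha> W))\<^sup>2) \<and>
    (\<forall>W.
      (norm (W - Wopt))\<^sup>2
        \<ge> (norm (pgd_step H A \<eta> \<alpha> W - Wopt))\<^sup>2
          + (1 - \<alpha> * L) * (norm (W - pgd_step H A \<eta> \<alpha> W))\<^sup>2)"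
proof -
  have opt: "Wopt \<in> feasible \<eta>"
    and min: "\<And>W. W \<in> feasible \<eta> \<Longrightarrow> objective H A Wopt \<le> objective H A W"
    using assms(4) by (auto simp: is_arg_min_def not_less)
  interpret projected_gradient "objective H A" "gradient H A" "feasible \<eta>" L \<alpha>
  proof
    show "closed (feasible \<eta> :: (complex ^ 'k ^ 'n) set)" by (rule closed_feasible)
    show "convex (feasible \<eta> :: (complex ^ 'k ^ 'n) set)" by (rule convex_feasible)
    show "(feasible \<eta> :: (complex ^ 'k ^ 'n) set) \<noteq> {}" using opt by blast
    show "continuous_on UNIV (gradient H A)" by (rule continuous_gradient_least_squares)
    show "objective H A X + gradient H A X \<bullet> (Y - X) \<le> objective H A Y" for X Y
      by (simp add: objective_expansion[of H A Y X])
    show "objective H A Y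
        \<le> objective H A X + gradient H A X \<bullet> (Y - X) + L / 2 * (norm (Y - X))\<^sup>2" for X Y
      using assms(3) by (simp add: is_Lipschitz_constant_def re_inner_F_eq_inner)
    show "0 < L" using assms(3) by (simp add: is_Lipschitz_constant_def)
    then show "0 < \<alpha>" and "\<alpha> * L < 1" using assms(5) by (auto simp: field_simps)
  qed
  have "pgd_step H A \<eta> \<alpha> = T"
    by (simp add: fun_eq_iff pgd_step_def T_def)
  then show ?thesis
    using iterates_convergent[OF opt min] sufficient_decrease distance_decrease[OF opt min]
    by auto
qed

end
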